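(* For all integers $n\ge k\ge 0$, $$L^{Y}(n,k)=\sum_{l=k}^{n}H_{\lambda}^{Y}(l,k){n \brack l}_{\lambda}.$$
   Context: Let $Y$ be a real random variable with $E[|Y|^{n}]<\infty$ for all integers $n\ge 0$ and $\lim_{n\to\infty}|t|^{n}E[|Y|^{n}]/n!=0$ for $|t|<r$, for some $r>0$. Let $Y_1,Y_2,\dots$ be i.i.d. copies of $Y$, $S_0=0$ and $S_k=Y_1+\cdots+Y_k$. Let $\langle x\rangle_0=1$, $\langle x\rangle_n=x(x+1)\cdots(x+n-1)$; the probabilistic Lah numbers are $L^{Y}(n,k)=\frac{1}{k!}\sum_{l=0}^{k}\binom{k}{l}(-1)^{k-l}E[\langle S_{l}\rangle_{n}]$ (equivalently $\frac1{k!}(E[(1-t)^{-Y}]-1)^k=\sum_{n\ge k}L^Y(n,k)t^n/n!$). Fix a nonzero real $\lambda$. Put $\langle x\rangle_{0,\lambda}=1$, $\langle x\rangle_{n,\lambda}=x(x+\lambda)\cdots(x+(n-1)\lambda)$, and $e_\lambda^{-Y}(-t)=(1-\lambda t)^{-Y/\lambda}$, so $E[e_\lambda^{-Y}(-t)]=\sum_{n\ge0}E[\langle Y\rangle_{n,\lambda}]t^n/n!$ near $t=0$. The probabilistic heterogeneous Stirling numbers of the second kind are defined by $\frac{1}{k!}(E[e_{\lambda}^{-Y}(-t)]-1)^{k}=\sum_{n\ge k}H_{\lambda}^{Y}(n,k)t^{n}/n!$. Let $\log_\lambda(1+t)=\frac{1}{\lambda}((1+t)^{\lambda}-1)$. The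 degenerate unsigned Stirling numbers of the first kind ${n\brack k}_\lambda$ are defined by $\frac{1}{k!}\big(-\log_{\lambda}(1-t)\big)^{k}=\sum_{n\ge k}{n \brack k}_{\lambda}\frac{t^{n}}{n!}$ for $k\ge0$. *)

theory Defs
  imports "HOL-Probability.Probability"
begin

text \<open>
  \<open>f t = (\<Sum>n\<ge>k. a n * t^n / n!)\<close> for all real \<open>t\<close> near \<open>0\<close>. The coefficients below \<open>k\<close>, which the
  series does not mention, are \<open>0\<close>; this makes \<open>a\<close> unique.
\<close>

definition has_egf_from :: "nat \<Rightarrow> (real \<Rightarrow> real) \<Rightarrow> (nat \<Rightarrow> real) \<Rightarrow> bool" where
  "has_egf_from k f a \<longleftrightarrow> (\<forall>n<k. a n = 0) \<and>
     (\<forall>\<^sub>F t in nhds 0. (\<lambda>n. a n * t ^ n / fact n) sums f t)"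

definition egf_coeff :: "nat \<Rightarrow> (real \<Rightarrow> real) \<Rightarrow> nat \<Rightarrow> real" where
  "egf_coeff k f = (THE a. has_egf_from k f a)"

lemma has_egf_from_unique:
  assumes "has_egf_from k f a" and "has_egf_from k f b"
  shows "a = b"
proof -
  have "\<forall>\<^sub>F t in nhds (0::real). (\<lambda>n. ((a n - b n) / fact n) * t ^ n) sums 0"
    using assms[unfolded has_egf_from_def, THEN conjunct2]
  proof eventually_elim
    case (elim t)
    from sums_diff[OF elim] show ?case
      by (simp add: algebra_simps diff_divide_distrib)
  qed
  then obtain e where e: "e > 0"
      "\<And>t. \<bar>t\<bar> < e \<Longrightarrow> (\<lambda>n. ((a n - b n) / fact n) * t ^ n) sums 0"
    unfolding eventually_nhds_metric by (auto simp: dist_real_def)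
  have "(a n - b n) / fact n = 0" for n
  proof (rule ccontr)
    assume *: "(a n - b n) / fact n \<noteq> 0"
    define m where "m = (LEAST m. (a m - b m) / fact m \<noteq> 0)"
    have m: "(a m - b m) / fact m \<noteq> 0"
      unfolding m_def using * by (rule LeastI)
    have less: "(a i - b i) / fact i = 0" if "i < m" for i
      using not_less_Least[of i "\<lambda>m. (a m - b m) / fact m \<noteq> 0"] that unfolding m_def by blast
    define c where "c = (\<lambda>n. (a (n + m) - b (n + m)) / fact (n + m))"
    have c: "(\<lambda>n. c n * t ^ n) sums 0" if "\<bar>t\<bar> < e" "t \<noteq> 0" for t
    proof -
      have "(\<lambda>n. ((a (n + m) - b (n + m)) / fact (n + m)) * t ^ (n + m)) sums 0"
        using sums_split_initial_segment[OF e(2)[OF that(1)], of m] less by simp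
      hence "(\<lambda>n. (c n * t ^ n) * t ^ m) sums (0 * t ^ m)"
        by (simp add: c_def power_add mult_ac)
      thus ?thesis using that(2) by (subst (asm) sums_mult2_iff) auto
    qed
    have "((\<lambda>_. 0) \<longlongrightarrow> c 0) (at (0::real))"
      by (rule powser_limit_0_strong[OF e(1), of c]) (use c in auto)
    hence "c 0 = 0"
      by (simp add: tendsto_const_iff)
    with m show False by (simp add: c_def)
  qed
  thus ?thesis by (auto simp: fun_eq_iff)
qed

lemma egf_coeff_eqI: "has_egf_from k f a \<Longrightarrow> egf_coeff k f = a"
  unfolding egf_coeff_def by (rule the_equality) (auto intro: has_egf_from_unique)

text \<open>The degenerate exponential \<open>e\<^sub>\<lambda>\<^sup>x(t) = (1 + \<lambda> t)\<^bsup>x/\<lambda>\<^esup>\<close> and the degenerate logarithm.\<close>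

definition degen_exp :: "real \<Rightarrow> real \<Rightarrow> real \<Rightarrow> real" where
  "degen_exp lam x t = (1 + lam * t) powr (x / lam)"

definition degen_log :: "real \<Rightarrow> real \<Rightarrow> real" where
  "degen_log lam u = (u powr lam - 1) / lam"

definition degen_stirling1 :: "real \<Rightarrow> nat \<Rightarrow> nat \<Rightarrow> real" where
  "degen_stirling1 lam n k =
     egf_coeff k (\<lambda>t. 1 / fact k * (- degen_log lam (1 - t)) ^ k) n"

definition prob_het_stirling2 :: "'a measure \<Rightarrow> ('a \<Rightarrow> real) \<Rightarrow> real \<Rightarrow> nat \<Rightarrow> nat \<Rightarrow> real" where
  "prob_het_stirling2 M Y lam n k =
     egf_coeff k (\<lambda>t. 1 / fact k * ((LINT \<omega>|M. degen_exp lam (- Y \<omega>) (- t)) - 1) ^ k) n"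

text \<open>
  The probabilistic Lah numbers, in terms of a sequence \<open>X 1, X 2, \<dots>\<close> of i.i.d. copies of \<open>Y\<close>
  living on the probability space \<open>N\<close>.
\<close>

definition prob_lah :: "'b measure \<Rightarrow> (nat \<Rightarrow> 'b \<Rightarrow> real) \<Rightarrow> nat \<Rightarrow> nat \<Rightarrow> real" where
  "prob_lah N X n k =
     1 / fact k * (\<Sum>l=0..k. of_nat (k choose l) * (-1) ^ (k - l) *
       (LINT \<omega>|N. pochhammer (\<Sum>i=1..l. X i \<omega>) n))"

end

theory Submission
  imports Defs "HOL-Complex_Analysis.Laurent_Convergence"
begin

text \<open>
  Let \<open>A\<close> and \<open>H\<close> be the power series of \<open>E[(1 - t)\<^bsup>-Y\<^esup>]\<close> and \<open>E[(1 - \<lambda> t)\<^bsup>-Y/\<lambda>\<^esup>]\<close>, and \<open>G\<close> that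
  of \<open>- log\<^sub>\<lambda> (1 - t)\<close>. For each value of \<open>Y\<close> the identity \<open>H \<circ> G = A\<close> is formal, and as every
  coefficient of a composition is a finite sum, it survives taking expectations. The theorem compares
  coefficients in \<open>(A - 1)\<^sup>k / k! = ((H - 1)\<^sup>k / k!) \<circ> G\<close>: on the left, the Vandermonde identity and
  independence turn \<open>A\<^sup>l\<close> into the series of the moments \<open>E[\<langle>S\<^sub>l\<rangle>\<^sub>n]\<close>. Analysis enters only in
  showing that \<open>H\<close> converges to its expectation near \<open>0\<close>, for which the moment hypothesis provides
  an exponential moment \<open>E[exp (c |Y|)]\<close> as dominating bound.
\<close>

unbundle no vec_syntax

section \<open>From analytic expansions to generating-function coefficients\<close>

text \<open>Near 0 the points lie inside the positive radius of convergence, so the series really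
  sums to \<open>f\<close>; uniqueness in \<open>egf_coeff\<close> then identifies the coefficients.
  The assumption on low coefficients matches the zeros that \<open>has_egf_from\<close> prescribes
  below \<open>k\<close>.\<close>

lemma has_fps_expansion_imp_egf_coeff:
  fixes f :: "real \<Rightarrow> real"
  assumes f: "f has_fps_expansion F" and F: "\<And>n. n < k \<Longrightarrow> F $ n = 0"
  shows "egf_coeff k f n = fact n * F $ n"
proof -
  have "\<forall>\<^sub>F t in nhds 0. t \<in> eball 0 (fps_conv_radius F)"
    using f by (intro eventually_nhds_in_open) (auto simp: has_fps_expansion_def zero_ereal_def)
  moreover have "\<forall>\<^sub>F t in nhds 0. eval_fps F t = f t"
    using f by (simp add: has_fps_expansion_def)
  ultimately have "\<forall>\<^sub>F t in nhds 0. (\<lambda>n. fact n * F $ n * t ^ n / fact n) sums f t"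
  proof eventually_elim
    case (elim t)
    then have "summable (\<lambda>n. F $ n * t ^ n)"
      by (intro summable_fps) auto
    with elim show ?case
      by (simp add: eval_fps_def sums_iff)
  qed
  with F have "has_egf_from k f (\<lambda>n. fact n * F $ n)"
    by (simp add: has_egf_from_def)
  from egf_coeff_eqI[OF this] show ?thesis by simp
qed

section \<open>Formal series and their composition\<close>

text \<open>For nonzero \<open>lam\<close> this is the series of
  \<open>(1 - lam * t) powr (- y / lam)\<close>: the numerator is the degenerate rising factorial
  \<open>y (y + lam) ... (y + (n - 1) lam)\<close>.\<close>

definition rising_fps :: "real \<Rightarrow> real \<Rightarrow> real fps" where
  "rising_fps lam y = Abs_fps (\<lambda>n. lam ^ n * pochhammer (y / lam) n / fact n)"

text \<open>The series of \<open>(1 - (1 - t) powr lam) / lam\<close>; composing with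
  \<open>- fps_X\<close> replaces \<open>1 + t\<close> by \<open>1 - t\<close>.\<close>

definition degen_log_fps :: "real \<Rightarrow> real fps" where
  "degen_log_fps lam = fps_const (1 / lam) * (1 - (fps_binomial lam oo (- fps_X)))"

text \<open>The formal law \<open>((1 + x)^a)^c = (1 + x)^(a c)\<close>. The composite satisfies the
  differential equation \<open>B' = a c B / (1 + x)\<close> with \<open>B(0) = 1\<close>, which
  determines the binomial series.\<close>

lemma fps_binomial_compose_binomial:
  fixes a c :: "'a::field_char_0"
  shows "fps_binomial c oo (fps_binomial a - 1) = fps_binomial (a * c)"
proof -
  define U where "U = fps_binomial a - 1"
  define B where "B = fps_binomial c oo U"
  have U0: "U $ 0 = 0" by (simp add: U_def)
  \<comment> \<open>Since \<open>1 + U\<close> is \<open>fps_binomial a\<close>, this factor later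
    cancels the one coming from \<open>fps_deriv U\<close>.\<close>
  have inv: "inverse (1 + fps_X) oo U = inverse (fps_binomial a)"
    using U0 by (simp add: fps_inverse_compose fps_compose_add_distrib U_def)
  have "fps_deriv B = (fps_deriv (fps_binomial c) oo U) * fps_deriv U"
    unfolding B_def by (rule fps_compose_deriv[OF U0])
  also have "fps_deriv (fps_binomial c) = fps_const c * fps_binomial c * inverse (1 + fps_X)"
    by (simp add: fps_binomial_deriv fps_divide_unit)
  also have "\<dots> oo U = fps_const c * B * inverse (fps_binomial a)"
    using U0 by (simp add: fps_compose_mult_distrib inv B_def)
  also have "fps_deriv U = fps_const a * fps_binomial a * inverse (1 + fps_X)"
    by (simp add: U_def fps_binomial_deriv fps_divide_unit)
  also have "fps_const c * B * inverse (fps_binomial a) * \<dots>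
      = (inverse (fps_binomial a) * fps_binomial a) * (fps_const (a * c) * B * inverse (1 + fps_X))"
    by (simp add: mult_ac flip: fps_const_mult)
  also have "inverse (fps_binomial a) * fps_binomial a = 1"
    by (intro inverse_mult_eq_1) simp
  finally have "fps_deriv B = fps_const (a * c) * B / (1 + fps_X)"
    by (simp add: fps_divide_unit)
  moreover have "B $ 0 = 1"
    by (simp add: B_def)
  ultimately show ?thesis
    using fps_binomial_ODE_unique'[of B "a * c"] by (simp add: B_def U_def)
qed

lemma rising_fps_eq_binomial_compose:
  "rising_fps lam y = fps_binomial (- y / lam) oo (fps_const (- lam) * fps_X)"
proof (rule fps_ext)
  fix n
  \<comment> \<open>The sign from the scaling cancels the sign in writing \<open>gchoose\<close> at
    a negated argument as a rising factorial.\<close>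
  have "(- lam) ^ n * (- 1) ^ n = lam ^ n"
    by (simp flip: power_mult_distrib)
  then show "rising_fps lam y $ n = (fps_binomial (- y / lam) oo (fps_const (- lam) * fps_X)) $ n"
    unfolding fps_nth_compose_linear
    by (simp add: rising_fps_def gbinomial_pochhammer flip: mult.assoc)
qed

text \<open>This is the formal counterpart of \<open>(1 - \<lambda> u)\<^bsup>-y/\<lambda>\<^esup> = (1 - t)\<^bsup>-y\<^esup>\<close> for \<open>u = (1 - (1 - t)\<^bsup>\<lambda>\<^esup>) / \<lambda>\<close>.\<close>

lemma rising_fps_compose_degen_log:
  assumes "lam \<noteq> 0"
  shows "rising_fps lam y oo degen_log_fps lam = rising_fps 1 y"
proof -
  have G0: "degen_log_fps lam $ 0 = 0"
    by (simp add: degen_log_fps_def)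
  have "(fps_const (- lam) * fps_X) oo degen_log_fps lam = fps_const (- lam) * degen_log_fps lam"
    using G0 by (simp add: fps_compose_mult_distrib del: fps_const_neg)
  also have "\<dots> = fps_const (- 1) * (1 - (fps_binomial lam oo (- fps_X)))"
    using assms by (simp add: degen_log_fps_def flip: mult.assoc)
  also have "\<dots> = (fps_binomial lam - 1) oo (- fps_X)"
    by (simp add: fps_compose_sub_distrib flip: fps_const_neg)
  finally have "rising_fps lam y oo degen_log_fps lam
      = fps_binomial (- y / lam) oo ((fps_binomial lam - 1) oo (- fps_X))"
    using G0 by (simp add: rising_fps_eq_binomial_compose flip: fps_compose_assoc)
  also have "\<dots> = fps_binomial (lam * (- y / lam)) oo (- fps_X)"
    by (simp add: fps_compose_assoc fps_binomial_compose_binomial del: times_divide_eq_right)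
  also have "\<dots> = rising_fps 1 y"
    using assms rising_fps_eq_binomial_compose[of 1 y] by (simp flip: fps_const_neg)
  finally show ?thesis .
qed

section \<open>The degenerate logarithm and Stirling numbers of the first kind\<close>

lemma degen_log_has_fps_expansion:
  "(\<lambda>t. - degen_log lam (1 - t)) has_fps_expansion degen_log_fps lam"
proof -
  have "(\<lambda>t. (1 - t) powr lam) has_fps_expansion (fps_binomial lam oo (- fps_X))"
  proof (rule has_fps_expansionI)
    have "\<forall>\<^sub>F t in nhds (0::real). t \<in> {-1<..<1}"
      by (intro eventually_nhds_in_open) auto
    then show "\<forall>\<^sub>F t in nhds (0::real). (\<lambda>n. (fps_binomial lam oo - fps_X) $ n * t ^ n) sums (1 - t) powr lam"
    proof eventually_elim
      case (elim t)
      then have "(\<lambda>n. (lam gchoose n) * (- t) ^ n) sums (1 + - t) powr lam"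
        by (intro gen_binomial_real) auto
      then show ?case
        by (simp add: fps_compose_uminus' power_minus[of t] mult_ac)
    qed
  qed
  then have "(\<lambda>t. 1 / lam * (1 - (1 - t) powr lam)) has_fps_expansion degen_log_fps lam"
    unfolding degen_log_fps_def by (intro fps_expansion_intros)
  moreover have "(\<lambda>t. 1 / lam * (1 - (1 - t) powr lam)) = (\<lambda>t. - degen_log lam (1 - t))"
    by (simp add: degen_log_def diff_divide_distrib)
  ultimately show ?thesis by simp
qed

lemma degen_stirling1_eq:
  "degen_stirling1 lam n k = fact n / fact k * (degen_log_fps lam ^ k) $ n"
proof -
  have "(\<lambda>t. 1 / fact k * (- degen_log lam (1 - t)) ^ k) has_fps_expansion
      fps_const (1 / fact k) * degen_log_fps lam ^ k"
    by (intro fps_expansion_intros degen_log_has_fps_expansion)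
  moreover have "degen_log_fps lam $ 0 = 0"
    by (simp add: degen_log_fps_def)
  ultimately show ?thesis
    unfolding degen_stirling1_def
    by (subst has_fps_expansion_imp_egf_coeff) (auto simp: startsby_zero_power_prefix)
qed

section \<open>Exponential moments as dominating bounds\<close>

lemma sums_pochhammer:
  fixes t x :: real
  assumes "\<bar>t\<bar> < 1"
  shows "(\<lambda>n. pochhammer x n / fact n * t ^ n) sums (1 - t) powr (- x)"
proof -
  have "(\<lambda>n. ((- x) gchoose n) * (- t) ^ n) sums (1 + - t) powr (- x)"
    using assms by (intro gen_binomial_real) auto
  moreover have "((- x) gchoose n) * (- t) ^ n = pochhammer x n / fact n * t ^ n" for n
  proof -
    have "(- 1) ^ n * (- t) ^ n = t ^ n"
      by (simp flip: power_mult_distrib)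
    then show ?thesis
      by (simp add: gbinomial_pochhammer mult_ac)
  qed
  ultimately show ?thesis by simp
qed

lemma abs_pochhammer_le: "\<bar>pochhammer x n\<bar> \<le> pochhammer \<bar>x\<bar> n" for x :: real
proof -
  have "\<bar>pochhammer x n\<bar> = (\<Prod>i<n. \<bar>x + of_nat i\<bar>)"
    by (simp add: pochhammer_prod abs_prod atLeast0LessThan)
  also have "\<dots> \<le> (\<Prod>i<n. \<bar>x\<bar> + of_nat i)"
    by (intro prod_mono) auto
  finally show ?thesis by (simp add: pochhammer_prod atLeast0LessThan)
qed

text \<open>Replacing \<open>x\<close> by \<open>\<bar>x\<bar>\<close> makes all terms nonnegative,
  and the full series is \<open>(1 - s) powr (- \<bar>x\<bar>)\<close>. The condition on
  \<open>s\<close> says \<open>1 - s \<ge> exp (- c)\<close>, which yields a bound uniform in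
  \<open>m\<close>.\<close>

lemma sum_abs_pochhammer_le_exp:
  fixes c s x :: real
  assumes "0 \<le> s" "s \<le> 1 - exp (- c)"
  shows "(\<Sum>n<m. \<bar>pochhammer x n\<bar> / fact n * s ^ n) \<le> exp (c * \<bar>x\<bar>)"
proof -
  have "s < 1" using assms exp_gt_zero[of "- c"] by linarith
  have "(\<Sum>n<m. \<bar>pochhammer x n\<bar> / fact n * s ^ n) \<le> (\<Sum>n<m. pochhammer \<bar>x\<bar> n / fact n * s ^ n)"
    using assms by (intro sum_mono mult_right_mono divide_right_mono abs_pochhammer_le) auto
  also have "\<dots> \<le> (1 - s) powr (- \<bar>x\<bar>)"
  proof -
    have "0 \<le> pochhammer \<bar>x\<bar> n" for n
      using abs_pochhammer_le[of x n] by linarith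
    then have "0 \<le> pochhammer \<bar>x\<bar> n / fact n * s ^ n" for n
      using assms by simp
    moreover have "(\<lambda>n. pochhammer \<bar>x\<bar> n / fact n * s ^ n) sums (1 - s) powr (- \<bar>x\<bar>)"
      using assms \<open>s < 1\<close> by (intro sums_pochhammer) auto
    ultimately show ?thesis
      using sum_le_suminf[of "\<lambda>n. pochhammer \<bar>x\<bar> n / fact n * s ^ n" "{..<m}"]
      by (simp add: sums_iff)
  qed
  also have "\<dots> \<le> exp (- c) powr (- \<bar>x\<bar>)"
    using assms by (intro powr_mono2') auto
  also have "\<dots> = exp (c * \<bar>x\<bar>)"
    by (simp add: powr_def)
  finally show ?thesis .
qed

lemma borel_measurable_pochhammer [measurable]:
  fixes f :: "'a \<Rightarrow> real"
  assumes [measurable]: "f \<in> borel_measurable M"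
  shows "(\<lambda>x. pochhammer (f x) n) \<in> borel_measurable M"
  unfolding pochhammer_prod by measurable

lemma integrable_pochhammer:
  fixes Z :: "'a \<Rightarrow> real"
  assumes [measurable]: "Z \<in> borel_measurable M"
    and "c > 0" and int: "integrable M (\<lambda>\<omega>. exp (c * \<bar>Z \<omega>\<bar>))"
  shows "integrable M (\<lambda>\<omega>. pochhammer (Z \<omega>) n)"
proof -
  define s where "s = 1 - exp (- c)"
  have s: "s > 0" using \<open>c > 0\<close> by (simp add: s_def)
  show ?thesis
  proof (rule Bochner_Integration.integrable_bound)
    show "integrable M (\<lambda>\<omega>. fact n / s ^ n * exp (c * \<bar>Z \<omega>\<bar>))"
      using int by simp
    \<comment> \<open>A single term is at most the whole nonnegative partial sum.\<close>
    have "\<bar>pochhammer x n\<bar> \<le> fact n / s ^ n * exp (c * \<bar>x\<bar>)" for x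
    proof -
      have "\<bar>pochhammer x n\<bar> / fact n * s ^ n \<le> (\<Sum>i<Suc n. \<bar>pochhammer x i\<bar> / fact i * s ^ i)"
        using s by (intro member_le_sum) auto
      also have "\<dots> \<le> exp (c * \<bar>x\<bar>)"
        using s by (intro sum_abs_pochhammer_le_exp) (auto simp: s_def)
      finally show ?thesis using s by (simp add: field_simps)
    qed
    then show "AE \<omega> in M. norm (pochhammer (Z \<omega>) n) \<le> norm (fact n / s ^ n * exp (c * \<bar>Z \<omega>\<bar>))"
      using s by simp
  qed measurable
qed

text \<open>Termwise integration of the binomial series:
  \<open>exp (c * \<bar>Z \<omega>\<bar>)\<close> dominates all partial sums of absolute values,
  both pointwise and after integration.\<close>

lemma integral_powr_sums:
  fixes Z :: "'a \<Rightarrow> real"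
  assumes Z [measurable]: "Z \<in> borel_measurable M"
    and "c > 0" and int: "integrable M (\<lambda>\<omega>. exp (c * \<bar>Z \<omega>\<bar>))"
    and t: "\<bar>t\<bar> \<le> 1 - exp (- c)"
  shows "(\<lambda>n. (LINT \<omega>|M. pochhammer (Z \<omega>) n) / fact n * t ^ n) sums
           (LINT \<omega>|M. (1 - t) powr (- Z \<omega>))"
proof -
  have t1: "\<bar>t\<bar> < 1" using t exp_gt_zero[of "- c"] by linarith
  let ?f = "\<lambda>n \<omega>. pochhammer (Z \<omega>) n / fact n * t ^ n"
  have norm: "norm (?f n \<omega>) = \<bar>pochhammer (Z \<omega>) n\<bar> / fact n * \<bar>t\<bar> ^ n" for n \<omega>
    by (simp add: abs_mult power_abs)
  have bound: "(\<Sum>n<m. norm (?f n \<omega>)) \<le> exp (c * \<bar>Z \<omega>\<bar>)" for m \<omega>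
    unfolding norm using t by (intro sum_abs_pochhammer_le_exp) auto
  have f: "integrable M (?f n)" for n
    using integrable_pochhammer[OF Z \<open>c > 0\<close> int] by simp
  have "(\<lambda>n. integral\<^sup>L M (?f n)) sums (LINT \<omega>|M. (\<Sum>n. ?f n \<omega>))"
  proof (rule sums_integral[OF f])
    show "AE \<omega> in M. summable (\<lambda>n. norm (?f n \<omega>))"
      by (intro AE_I2 summableI_nonneg_bounded[OF _ bound]) simp
    show "summable (\<lambda>n. LINT \<omega>|M. norm (?f n \<omega>))"
    proof (rule summableI_nonneg_bounded)
      show "(\<Sum>n<m. LINT \<omega>|M. norm (?f n \<omega>)) \<le> (LINT \<omega>|M. exp (c * \<bar>Z \<omega>\<bar>))" for m
      proof -
        have "(\<Sum>n<m. LINT \<omega>|M. norm (?f n \<omega>)) = (LINT \<omega>|M. (\<Sum>n<m. norm (?f n \<omega>)))"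
          using f by (intro Bochner_Integration.integral_sum[symmetric] integrable_norm)
        also have "\<dots> \<le> (LINT \<omega>|M. exp (c * \<bar>Z \<omega>\<bar>))"
          using f by (intro integral_mono Bochner_Integration.integrable_sum integrable_norm int bound)
        finally show ?thesis .
      qed
    qed simp
  qed
  moreover have "(\<Sum>n. ?f n \<omega>) = (1 - t) powr (- Z \<omega>)" for \<omega>
    using sums_pochhammer[OF t1] by (simp add: sums_iff)
  ultimately show ?thesis by simp
qed

text \<open>The exponential is integrated term by term. The limit at \<open>s\<close> bounds the
  scaled moments by some \<open>B\<close>, so the integrated terms are at most
  \<open>B * (c / s) ^ m\<close>, a geometric series since \<open>c < s\<close>.\<close>

lemma integrable_exp_abs_if_moments:
  fixes Y :: "'a \<Rightarrow> real"
  assumes mom: "\<And>m::nat. integrable M (\<lambda>\<omega>. \<bar>Y \<omega>\<bar> ^ m)"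
    and "0 \<le> c" "c < s"
    and lim: "(\<lambda>m. s ^ m * (LINT \<omega>|M. \<bar>Y \<omega>\<bar> ^ m) / fact m) \<longlonglongrightarrow> 0"
  shows "integrable M (\<lambda>\<omega>. exp (c * \<bar>Y \<omega>\<bar>))"
proof -
  have s: "s > 0" using assms by linarith
  let ?f = "\<lambda>m \<omega>. (c * \<bar>Y \<omega>\<bar>) ^ m / fact m"
  have sums: "(\<lambda>m. ?f m \<omega>) sums exp (c * \<bar>Y \<omega>\<bar>)" for \<omega>
    using exp_converges[of "c * \<bar>Y \<omega>\<bar>"] by (simp add: field_simps)
  have nn: "norm (?f m \<omega>) = ?f m \<omega>" for m \<omega>
    using \<open>0 \<le> c\<close> by simp
  have int: "integrable M (?f m)" for m
    using mom[of m] by (simp add: power_mult_distrib)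
  obtain B where B: "\<And>m. norm (s ^ m * (LINT \<omega>|M. \<bar>Y \<omega>\<bar> ^ m) / fact m) \<le> B"
    using convergent_imp_Bseq[OF convergentI[OF lim]] by (auto simp: Bseq_def)
  have "integrable M (\<lambda>\<omega>. \<Sum>m. ?f m \<omega>)"
  proof (rule integrable_suminf[OF int])
    show "AE \<omega> in M. summable (\<lambda>m. norm (?f m \<omega>))"
      unfolding nn using sums by (auto simp: sums_iff)
    show "summable (\<lambda>m. LINT \<omega>|M. norm (?f m \<omega>))"
    proof (rule summable_comparison_test')
      show "summable (\<lambda>m. B * (c / s) ^ m)"
        using assms s by (intro summable_mult summable_geometric) auto
      show "norm (LINT \<omega>|M. norm (?f m \<omega>)) \<le> B * (c / s) ^ m" for m
      proof -
        have "(LINT \<omega>|M. norm (?f m \<omega>)) = (s ^ m * (LINT \<omega>|M. \<bar>Y \<omega>\<bar> ^ m) / fact m) * (c / s) ^ m"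
          unfolding nn using s by (simp add: power_mult_distrib power_divide)
        then have "norm (LINT \<omega>|M. norm (?f m \<omega>))
            = norm (s ^ m * (LINT \<omega>|M. \<bar>Y \<omega>\<bar> ^ m) / fact m) * (c / s) ^ m"
          using s \<open>0 \<le> c\<close> by (simp only: norm_mult norm_power) simp
        also have "\<dots> \<le> B * (c / s) ^ m"
          using s \<open>0 \<le> c\<close> by (intro mult_right_mono B) auto
        finally show ?thesis .
      qed
    qed
  qed
  then show ?thesis
    using sums by (simp add: sums_iff)
qed

section \<open>Expected series and Stirling numbers of the second kind\<close>

text \<open>The expectation is taken coefficientwise, so formal identities can be averaged without
  discussing convergence in \<open>t\<close>.\<close>

definition mean_rising_fps :: "'a measure \<Rightarrow> ('a \<Rightarrow> real) \<Rightarrow> real \<Rightarrow> real fps" where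
  "mean_rising_fps M Y lam = Abs_fps (\<lambda>n. LINT \<omega>|M. rising_fps lam (Y \<omega>) $ n)"

lemma mean_degen_exp_has_fps_expansion:
  fixes Y :: "'a \<Rightarrow> real"
  assumes Y [measurable]: "Y \<in> borel_measurable M"
    and "c > 0" and int: "integrable M (\<lambda>\<omega>. exp (c * \<bar>Y \<omega>\<bar>))" and "lam \<noteq> 0"
  shows "(\<lambda>t. LINT \<omega>|M. degen_exp lam (- Y \<omega>) (- t)) has_fps_expansion mean_rising_fps M Y lam"
proof (rule has_fps_expansionI)
  \<comment> \<open>The series is that of \<open>Y / lam\<close> at the point
    \<open>lam * t\<close>; this \<open>d\<close> makes \<open>d * \<bar>Y / lam\<bar>\<close> equal
    to \<open>c * \<bar>Y\<bar>\<close>.\<close>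
  define d where "d = c * \<bar>lam\<bar>"
  have d: "d > 0" using assms by (simp add: d_def)
  have int': "integrable M (\<lambda>\<omega>. exp (d * \<bar>Y \<omega> / lam\<bar>))"
    using int \<open>lam \<noteq> 0\<close> by (simp add: d_def abs_divide)
  have "((\<lambda>t. \<bar>lam * t\<bar>) \<longlongrightarrow> \<bar>lam * 0\<bar>) (nhds 0)"
    by (intro tendsto_intros filterlim_ident)
  then have "\<forall>\<^sub>F t in nhds 0. \<bar>lam * t\<bar> < 1 - exp (- d)"
    by (rule order_tendstoD) (use d in auto)
  then show "\<forall>\<^sub>F t in nhds 0. (\<lambda>n. mean_rising_fps M Y lam $ n * t ^ n) sums
      (LINT \<omega>|M. degen_exp lam (- Y \<omega>) (- t))"
  proof eventually_elim
    case (elim t)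
    then have "(\<lambda>n. (LINT \<omega>|M. pochhammer (Y \<omega> / lam) n) / fact n * (lam * t) ^ n) sums
        (LINT \<omega>|M. (1 - lam * t) powr (- (Y \<omega> / lam)))"
      using d int' by (intro integral_powr_sums[where c = d]) auto
    then show ?case
      by (simp add: mean_rising_fps_def rising_fps_def degen_exp_def power_mult_distrib mult_ac)
  qed
qed

lemma (in prob_space) prob_het_stirling2_eq:
  assumes "Y \<in> borel_measurable M"
    and "c > 0" and "integrable M (\<lambda>\<omega>. exp (c * \<bar>Y \<omega>\<bar>))" and "lam \<noteq> 0"
  shows "prob_het_stirling2 M Y lam n k =
    fact n / fact k * ((mean_rising_fps M Y lam - 1) ^ k) $ n"
proof -
  have "(\<lambda>t. 1 / fact k * ((LINT \<omega>|M. degen_exp lam (- Y \<omega>) (- t)) - 1) ^ k) has_fps_expansion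
      fps_const (1 / fact k) * (mean_rising_fps M Y lam - 1) ^ k"
    by (intro fps_expansion_intros mean_degen_exp_has_fps_expansion[OF assms])
  \<comment> \<open>The constant coefficient of the mean series is the total mass 1, so the
    \<open>k\<close>-th power starts at degree \<open>k\<close> or later, as the passage to
    \<open>egf_coeff k\<close> requires.\<close>
  moreover have "(mean_rising_fps M Y lam - 1) $ 0 = 0"
    by (simp add: mean_rising_fps_def rising_fps_def prob_space)
  ultimately show ?thesis
    unfolding prob_het_stirling2_def
    by (subst has_fps_expansion_imp_egf_coeff) (auto simp: startsby_zero_power_prefix)
qed

lemma mean_rising_fps_compose_degen_log:
  fixes Y :: "'a \<Rightarrow> real"
  assumes "Y \<in> borel_measurable M"
    and "c > 0" and "integrable M (\<lambda>\<omega>. exp (c * \<bar>Y \<omega>\<bar>))" and "lam \<noteq> 0"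
  shows "mean_rising_fps M Y lam oo degen_log_fps lam = mean_rising_fps M Y 1"
proof (rule fps_ext)
  fix n
  have "integrable M (\<lambda>\<omega>. pochhammer (Y \<omega> / lam) i)" for i
  proof (rule integrable_pochhammer)
    show "integrable M (\<lambda>\<omega>. exp (c * \<bar>lam\<bar> * \<bar>Y \<omega> / lam\<bar>))"
      using assms by (simp add: abs_divide)
  qed (use assms in auto)
  then have int: "integrable M (\<lambda>\<omega>. rising_fps lam (Y \<omega>) $ i)" for i
    by (simp add: rising_fps_def)
  have "(mean_rising_fps M Y lam oo degen_log_fps lam) $ n
      = (\<Sum>i=0..n. LINT \<omega>|M. rising_fps lam (Y \<omega>) $ i * (degen_log_fps lam ^ i) $ n)"
    by (simp add: fps_compose_nth mean_rising_fps_def)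
  also have "\<dots> = (LINT \<omega>|M. (\<Sum>i=0..n. rising_fps lam (Y \<omega>) $ i * (degen_log_fps lam ^ i) $ n))"
    using int by (intro Bochner_Integration.integral_sum[symmetric] integrable_mult_left)
  also have "\<dots> = (LINT \<omega>|M. (rising_fps lam (Y \<omega>) oo degen_log_fps lam) $ n)"
    by (simp add: fps_compose_nth)
  also have "\<dots> = mean_rising_fps M Y 1 $ n"
    by (simp add: rising_fps_compose_degen_log[OF \<open>lam \<noteq> 0\<close>] mean_rising_fps_def)
  finally show "(mean_rising_fps M Y lam oo degen_log_fps lam) $ n = mean_rising_fps M Y 1 $ n" .
qed

section \<open>Sums of independent copies and Lah numbers\<close>

lemma rising_fps_1_add: "rising_fps 1 (x + y) = rising_fps 1 x * rising_fps 1 y"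
proof (rule fps_ext)
  fix n
  have "pochhammer (x + y) n / fact n
      = (\<Sum>i\<le>n. of_nat (n choose i) * pochhammer x i * pochhammer y (n - i) / fact n)"
    by (simp add: pochhammer_binomial_sum sum_divide_distrib)
  also have "\<dots> = (\<Sum>i\<le>n. (pochhammer x i / fact i) * (pochhammer y (n - i) / fact (n - i)))"
    by (intro sum.cong refl) (simp add: binomial_fact)
  finally show "rising_fps 1 (x + y) $ n = (rising_fps 1 x * rising_fps 1 y) $ n"
    by (simp add: rising_fps_def fps_mult_nth atLeast0AtMost)
qed

text \<open>Independence turns each summand of the Vandermonde convolution into a product of
  expectations. That needs integrable factors, so integrability is carried through the
  induction.\<close>

lemma (in prob_space) mean_rising_fps_sum:
  fixes X :: "nat \<Rightarrow> 'a \<Rightarrow> real"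
  assumes indep: "indep_vars (\<lambda>_. borel) X {1..}"
    and int: "\<And>i n. i \<ge> 1 \<Longrightarrow> integrable M (\<lambda>\<omega>. pochhammer (X i \<omega>) n)"
    and A: "\<And>i. i \<ge> 1 \<Longrightarrow> mean_rising_fps M (X i) 1 = A"
  shows "(\<forall>n. integrable M (\<lambda>\<omega>. rising_fps 1 (\<Sum>i=1..l. X i \<omega>) $ n)) \<and>
    mean_rising_fps M (\<lambda>\<omega>. \<Sum>i=1..l. X i \<omega>) 1 = A ^ l"
proof (induction l)
  case 0
  have "rising_fps 1 0 = 1"
    by (rule fps_ext) (simp add: rising_fps_def pochhammer_0_left)
  then show ?case
    by (auto simp: mean_rising_fps_def fps_eq_iff prob_space)
next
  case (Suc l)
  let ?S = "\<lambda>\<omega>. \<Sum>i=1..l. X i \<omega>"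
  let ?X = "X (Suc l)"
  \<comment> \<open>Splitting off the last index makes it independent of the sum over the remaining
    ones.\<close>
  have "indep_vars (\<lambda>_. borel) X (insert (Suc l) {1..l})"
    by (rule indep_vars_subset[OF indep]) auto
  then have XS: "indep_var borel ?X borel ?S"
    by (intro indep_vars_sum) auto
  have meas: "(\<lambda>x. rising_fps 1 x $ i) \<in> borel_measurable borel" for i
    by (simp add: rising_fps_def)
  have ind: "indep_var borel (\<lambda>\<omega>. rising_fps 1 (?X \<omega>) $ i) borel (\<lambda>\<omega>. rising_fps 1 (?S \<omega>) $ j)" for i j
    using indep_var_compose[OF XS meas meas] by (simp add: comp_def)
  have intX: "integrable M (\<lambda>\<omega>. rising_fps 1 (?X \<omega>) $ i)" for i
    using int[of "Suc l"] by (simp add: rising_fps_def)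
  have intS: "integrable M (\<lambda>\<omega>. rising_fps 1 (?S \<omega>) $ i)" for i
    using Suc.IH by blast
  note prod = indep_var_integrable[OF ind intX intS] indep_var_lebesgue_integral[OF ind intX intS]
  have eq: "rising_fps 1 (\<Sum>i=1..Suc l. X i \<omega>) $ n
      = (\<Sum>i=0..n. rising_fps 1 (?X \<omega>) $ i * rising_fps 1 (?S \<omega>) $ (n - i))" for n \<omega>
  proof -
    have "(\<Sum>i=1..Suc l. X i \<omega>) = ?X \<omega> + ?S \<omega>" by simp
    then show ?thesis by (simp only: rising_fps_1_add fps_mult_nth)
  qed
  have "mean_rising_fps M (\<lambda>\<omega>. \<Sum>i=1..Suc l. X i \<omega>) 1
      = mean_rising_fps M ?X 1 * mean_rising_fps M ?S 1"
  proof (rule fps_ext)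
    fix n
    show "mean_rising_fps M (\<lambda>\<omega>. \<Sum>i=1..Suc l. X i \<omega>) 1 $ n
        = (mean_rising_fps M ?X 1 * mean_rising_fps M ?S 1) $ n"
      unfolding mean_rising_fps_def fps_mult_nth fps_nth_Abs_fps eq
      \<comment> \<open>Simplification rewrites the lower summation bound \<open>1\<close> to
        \<open>Suc 0\<close>, hence the unfolded form of the product rules.\<close>
      by (subst Bochner_Integration.integral_sum) (auto simp: prod[unfolded One_nat_def])
  qed
  also have "\<dots> = A ^ Suc l"
    using Suc.IH A[of "Suc l"] by simp
  finally show ?case
    unfolding eq using prod by auto
qed

text \<open>The alternating sum in \<open>prob_lah\<close> is the binomial expansion of
  \<open>(A - 1) ^ k\<close>, with \<open>A ^ l\<close> encoding the rising moments of the
  \<open>l\<close>-fold sum.\<close>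

lemma (in prob_space) prob_lah_eq:
  fixes X :: "nat \<Rightarrow> 'a \<Rightarrow> real"
  assumes "indep_vars (\<lambda>_. borel) X {1..}"
    and "\<And>i n. i \<ge> 1 \<Longrightarrow> integrable M (\<lambda>\<omega>. pochhammer (X i \<omega>) n)"
    and "\<And>i. i \<ge> 1 \<Longrightarrow> mean_rising_fps M (X i) 1 = A"
  shows "prob_lah M X n k = fact n / fact k * ((A - 1) ^ k) $ n"
proof -
  have E: "(LINT \<omega>|M. pochhammer (\<Sum>i=1..l. X i \<omega>) n) = fact n * (A ^ l) $ n" for l
  proof -
    have "(A ^ l) $ n = mean_rising_fps M (\<lambda>\<omega>. \<Sum>i=1..l. X i \<omega>) 1 $ n"
      using mean_rising_fps_sum[OF assms] by simp
    then show ?thesis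
      by (simp add: mean_rising_fps_def rising_fps_def)
  qed
  have "(A - 1) ^ k = (\<Sum>l\<le>k. of_nat (k choose l) * A ^ l * (- 1) ^ (k - l))"
    using binomial_ring[of A "- 1" k] by simp
  also have "\<dots> = (\<Sum>l\<le>k. fps_const (of_nat (k choose l) * (- 1) ^ (k - l)) * A ^ l)"
    by (intro sum.cong refl)
       (simp add: mult_ac fps_of_nat flip: fps_const_mult fps_const_power fps_const_neg)
  finally show ?thesis
    unfolding prob_lah_def E
    by (simp add: fps_sum_nth sum_distrib_left atLeast0AtMost mult_ac)
qed

section \<open>Comparison of coefficients in the composed series\<close>

theorem theorem2p4:
  fixes M :: "'a measure" and Y :: "'a \<Rightarrow> real"
    and N :: "'b measure" and X :: "nat \<Rightarrow> 'b \<Rightarrow> real"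
    and r lam :: real and n k :: nat
  assumes "prob_space M"
    and "Y \<in> borel_measurable M"
    and "\<And>m::nat. integrable M (\<lambda>\<omega>. \<bar>Y \<omega>\<bar> ^ m)"
    and "r > 0"
    and "\<And>t::real. \<bar>t\<bar> < r \<Longrightarrow>
           (\<lambda>m. \<bar>t\<bar> ^ m * (LINT \<omega>|M. \<bar>Y \<omega>\<bar> ^ m) / fact m) \<longlonglongrightarrow> 0"
    and "prob_space N"
    and "prob_space.indep_vars N (\<lambda>_. borel) X {1..}"
    and "\<And>i. i \<ge> 1 \<Longrightarrow> distr N borel (X i) = distr M borel Y"
    and "lam \<noteq> 0"
    and "k \<le> n"
  shows "prob_lah N X n k =
    (\<Sum>l=k..n. prob_het_stirling2 M Y lam l k * degen_stirling1 lam n l)"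
proof -
  interpret M: prob_space M by fact
  interpret N: prob_space N by fact
  note [measurable] = assms(2)
  \<comment> \<open>Any \<open>c < s < r\<close> would do; \<open>s = r / 2\<close> is taken
    below.\<close>
  define c where "c = r / 3"
  have c: "c > 0" using \<open>r > 0\<close> by (simp add: c_def)
  have int: "integrable M (\<lambda>\<omega>. exp (c * \<bar>Y \<omega>\<bar>))"
    using assms(3) assms(5)[of "r / 2"] \<open>r > 0\<close>
    by (intro integrable_exp_abs_if_moments[where s = "r / 2"]) (auto simp: c_def)
  have X [measurable]: "X i \<in> borel_measurable N" if "i \<ge> 1" for i
    using assms(7) that by (auto simp: N.indep_vars_def)
  define A where "A = mean_rising_fps M Y 1"
  define H where "H = mean_rising_fps M Y lam"
  define G where "G = degen_log_fps lam"
  have G0: "G $ 0 = 0" by (simp add: G_def degen_log_fps_def)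
  have H0: "(H - 1) $ 0 = 0"
    by (simp add: H_def mean_rising_fps_def rising_fps_def M.prob_space)
  have "prob_lah N X n k = fact n / fact k * ((A - 1) ^ k) $ n"
  proof (rule N.prob_lah_eq[OF assms(7)])
    fix i :: nat assume i: "i \<ge> 1"
    note [measurable] = X[OF i]
    \<comment> \<open>This and the next fact depend only on the law, so they transfer from
      \<open>Y\<close> to \<open>X i\<close> through the common image measure.\<close>
    show "integrable N (\<lambda>\<omega>. pochhammer (X i \<omega>) m)" for m
    proof -
      have "integrable (distr N borel (X i)) (\<lambda>x. pochhammer x m)"
        unfolding assms(8)[OF i]
        using integrable_pochhammer[OF assms(2) c int] by (simp add: integrable_distr_eq)
      then show ?thesis by (simp add: integrable_distr_eq)
    qed
    show "mean_rising_fps N (X i) 1 = A"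
    proof (rule fps_ext)
      fix m
      have meas: "(\<lambda>x. rising_fps 1 x $ m) \<in> borel_measurable borel"
        by (simp add: rising_fps_def)
      have "mean_rising_fps N (X i) 1 $ m = (LINT x|distr N borel (X i). rising_fps 1 x $ m)"
        using meas by (simp add: mean_rising_fps_def integral_distr)
      also have "\<dots> = A $ m"
        unfolding assms(8)[OF i] using meas by (simp add: A_def mean_rising_fps_def integral_distr)
      finally show "mean_rising_fps N (X i) 1 $ m = A $ m" .
    qed
  qed
  also have "(A - 1) ^ k = (H - 1) ^ k oo G"
    using mean_rising_fps_compose_degen_log[OF assms(2) c int \<open>lam \<noteq> 0\<close>] G0
    by (simp add: A_def H_def G_def fps_compose_sub_distrib flip: fps_compose_power)
  \<comment> \<open>The terms with \<open>l < k\<close> vanish because \<open>H - 1\<close> has no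
    constant term.\<close>
  also have "\<dots> $ n = (\<Sum>l=k..n. ((H - 1) ^ k) $ l * (G ^ l) $ n)"
    unfolding fps_compose_nth using startsby_zero_power_prefix[OF H0, of k]
    by (intro sum.mono_neutral_right) (auto simp: not_le)
  \<comment> \<open>The factor \<open>fact l / fact k\<close> of the second kind and
    \<open>fact n / fact l\<close> of the first kind multiply to
    \<open>fact n / fact k\<close>.\<close>
  also have "fact n / fact k * \<dots> =
      (\<Sum>l=k..n. prob_het_stirling2 M Y lam l k * degen_stirling1 lam n l)"
    unfolding M.prob_het_stirling2_eq[OF assms(2) c int \<open>lam \<noteq> 0\<close>] degen_stirling1_eq
    by (simp add: sum_distrib_left H_def G_def mult_ac)
  finally show ?thesis .
qed

end
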